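(* Let $b(\lambda)$ and $q(\lambda)$ be invertible one-space dynamical matrices, let $R_{12}$ and $\tilde R_{12}$ be non-dynamical solutions of the Yang–Baxter equation, and let $$A_{12}=b_1^{-1}b_2^{-1}R_{12}b_1b_2,\quad B_{12}=b_2^{-1}b_2(h_1),\quad C_{12}=b_1^{-1}b_1(h_2),\quad D_{12}=q_1(h_2)^{-1}q_2^{-1}\tilde R_{12}\,q_1\,q_2(h_1).$$ Let $\mathcal Q$ be a non-dynamical matrix on the auxiliary space, either scalar or with entries in an associative unital algebra over $\mathbb C$ (operatorial case), satisfying $$R_{12}\,\mathcal Q_1\,\mathcal Q_2=\mathcal Q_2\,\mathcal Q_1\,\tilde R_{12}.$$ Then $K(\lambda)=b(\lambda)^{-1}\,\mathcal Q\,q(\lambda)$ is a solution of the semi-dynamical reflection equation $$A_{12}\,K_1\,B_{12}\,K_2(h_1)=K_2\,C_{12}\,K_1(h_2)\,D_{12}.$$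
   Context: Setting. Fix $n\ge 1$, $V=\mathbb C^n$ with matrix units $e_{ij}$; $h_i=e_{ii}$ is the basis of the Cartan subalgebra $\mathfrak h$ of $gl(n)$; $\gamma\in\mathbb C$, $\gamma\neq0$; $\lambda\in\mathbb C^n$ are the dynamical variables; $\epsilon_i$ is the $i$-th standard basis vector. The auxiliary space is $V$, or $V\otimes\mathbb C[[u]]$ in which case matrices have coefficients in formal power series and space $j$ carries the parameter $u_j$. A "dynamical matrix" is a scalar (c-number) function of $\lambda$ with values in $\mathrm{End}(V)$ (one-space) or $\mathrm{End}(V)\otimes\mathrm{End}(V)$ (two-space), possibly with power series coefficients; invertible means invertible for every $\lambda$. Scalar matrix entries commute with the elements of the algebra in which $\mathcal Q$ has its entries. Subscripts indicate the tensor factors in which a matrix acts; the argument $\lambda$ is omitted. "Non-dynamical" means invariant under $\lambda\mapsto\lambda+\gamma\epsilon_i$ for every $i$. The Yang–Baxter equation is $R_{12}R_{13}R_{23}=R_{23}R_{13}R_{12}$. Dynamical shift. If $f(\lambda)$ does not act in space $a$, then $f(h_a)=f(\lambda+\gamma h_a):=\sum_{i=1}^n f(\lambda+\gamma\epsilon_i)(e_{ii})_a$. *)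

theory Defs
  imports "HOL-Analysis.Analysis" "HOL-Computational_Algebra.Formal_Power_Series"
begin

locale complex_algebra = vector_space smul
  for smul :: "complex \<Rightarrow> 'a::ring_1 \<Rightarrow> 'a" +
  assumes smul_mult_left: "smul c x * y = smul c (x * y)"
    and smul_mult_right: "x * smul c y = smul c (x * y)"

text \<open>The structure map, through which scalar matrix entries act in the algebra; its values are
  central.  Scalar matrices are the case of the algebra of complex numbers itself.\<close>

definition of_scalar :: "(complex \<Rightarrow> 'a::ring_1 \<Rightarrow> 'a) \<Rightarrow> complex \<Rightarrow> 'a" where
  "of_scalar smul c = smul c 1"

lemma complex_algebra_complex: "complex_algebra ((*) :: complex \<Rightarrow> complex \<Rightarrow> complex)"
  by unfold_locales (simp_all add: algebra_simps)

lemma of_scalar_complex: "of_scalar (*) = id"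
  by (simp add: fun_eq_iff of_scalar_def)

text \<open>An element of End(V) with coefficients in a ring is a square matrix indexed by the finite type
  \<open>'n\<close>.  The basis vectors of the tensor square and cube of V are indexed by \<open>'n \<times> 'n\<close> and
  \<open>'n \<times> 'n \<times> 'n\<close>.  The product of coefficients is not assumed to be commutative.\<close>

definition in_space_1 :: "'c::zero^'n^'n \<Rightarrow> 'c^('n \<times> 'n)^('n \<times> 'n)" where
  "in_space_1 M = (\<chi> r s. if snd r = snd s then M $ fst r $ fst s else 0)"

definition in_space_2 :: "'c::zero^'n^'n \<Rightarrow> 'c^('n \<times> 'n)^('n \<times> 'n)" where
  "in_space_2 M = (\<chi> r s. if fst r = fst s then M $ snd r $ snd s else 0)"

definition in_space_12 ::
    "'c::zero^('n::finite \<times> 'n)^('n \<times> 'n) \<Rightarrow> 'c^('n \<times> 'n \<times> 'n)^('n \<times> 'n \<times> 'n)" where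
  "in_space_12 M = (\<chi> r s. case (r, s) of ((i, j, k), (i', j', k')) \<Rightarrow>
     if k = k' then M $ (i, j) $ (i', j') else 0)"

definition in_space_13 ::
    "'c::zero^('n::finite \<times> 'n)^('n \<times> 'n) \<Rightarrow> 'c^('n \<times> 'n \<times> 'n)^('n \<times> 'n \<times> 'n)" where
  "in_space_13 M = (\<chi> r s. case (r, s) of ((i, j, k), (i', j', k')) \<Rightarrow>
     if j = j' then M $ (i, k) $ (i', k') else 0)"

definition in_space_23 ::
    "'c::zero^('n::finite \<times> 'n)^('n \<times> 'n) \<Rightarrow> 'c^('n \<times> 'n \<times> 'n)^('n \<times> 'n \<times> 'n)" where
  "in_space_23 M = (\<chi> r s. case (r, s) of ((i, j, k), (i', j', k')) \<Rightarrow>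
     if i = i' then M $ (j, k) $ (j', k') else 0)"

text \<open>Power series in \<open>u\<^sub>1, u\<^sub>2\<close> and in \<open>u\<^sub>1, u\<^sub>2, u\<^sub>3\<close> are iterated power series whose innermost
  variable is \<open>u\<^sub>1\<close>: in \<open>'c fps fps\<close> the coefficient of the monomial with exponents i of \<open>u\<^sub>1\<close> and
  j of \<open>u\<^sub>2\<close> is \<open>fps_nth (fps_nth F j) i\<close>.  A one-space matrix has entries in a single unnamed variable, and a
  two-space matrix has entries in two; placing it in given tensor factors also substitutes the
  parameters of these factors.\<close>

definition map_fps :: "('c \<Rightarrow> 'd) \<Rightarrow> 'c fps \<Rightarrow> 'd fps" where
  "map_fps f F = Abs_fps (\<lambda>n. f (fps_nth F n))"

definition in_space_1_u :: "'c::zero fps^'n^'n \<Rightarrow> 'c fps fps^('n \<times> 'n)^('n \<times> 'n)" where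
  "in_space_1_u M = in_space_1 (map_matrix fps_const M)"

definition in_space_2_u :: "'c::zero fps^'n^'n \<Rightarrow> 'c fps fps^('n \<times> 'n)^('n \<times> 'n)" where
  "in_space_2_u M = in_space_2 (map_matrix (map_fps fps_const) M)"

definition in_space_12_u ::
    "'c::zero fps fps^('n::finite \<times> 'n)^('n \<times> 'n) \<Rightarrow> 'c fps fps fps^('n \<times> 'n \<times> 'n)^('n \<times> 'n \<times> 'n)" where
  "in_space_12_u M = in_space_12 (map_matrix fps_const M)"

definition in_space_13_u ::
    "'c::zero fps fps^('n::finite \<times> 'n)^('n \<times> 'n) \<Rightarrow> 'c fps fps fps^('n \<times> 'n \<times> 'n)^('n \<times> 'n \<times> 'n)" where
  "in_space_13_u M = in_space_13 (map_matrix (map_fps fps_const) M)"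

definition in_space_23_u ::
    "'c::zero fps fps^('n::finite \<times> 'n)^('n \<times> 'n) \<Rightarrow> 'c fps fps fps^('n \<times> 'n \<times> 'n)^('n \<times> 'n \<times> 'n)" where
  "in_space_23_u M = in_space_23 (map_matrix (map_fps (map_fps fps_const)) M)"

definition non_dynamical :: "complex \<Rightarrow> (complex^'n \<Rightarrow> 'x) \<Rightarrow> bool" where
  "non_dynamical \<gamma> F \<longleftrightarrow> (\<forall>\<Lambda> i. F (\<Lambda> + \<gamma> *s axis i 1) = F \<Lambda>)"

definition diag_unit :: "'n \<Rightarrow> 'c::{zero,one}^'n^'n" where
  "diag_unit i = (\<chi> j k. if j = i \<and> k = i then 1 else 0)"

text \<open>\<open>shift_h1 \<gamma> F\<close> is \<open>F(h\<^sub>1)\<close>, to be used only for F that do not act in space 1; similarly for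
  \<open>shift_h2\<close>.\<close>

definition shift_h1 ::
    "complex \<Rightarrow> (complex^'n \<Rightarrow> 'c::semiring_1^('n \<times> 'n)^('n \<times> 'n))
      \<Rightarrow> complex^'n \<Rightarrow> 'c^('n \<times> 'n)^('n \<times> 'n)" where
  "shift_h1 \<gamma> F \<Lambda> = (\<Sum>i\<in>UNIV. F (\<Lambda> + \<gamma> *s axis i 1) ** in_space_1 (diag_unit i))"

definition shift_h2 ::
    "complex \<Rightarrow> (complex^'n \<Rightarrow> 'c::semiring_1^('n \<times> 'n)^('n \<times> 'n))
      \<Rightarrow> complex^'n \<Rightarrow> 'c^('n \<times> 'n)^('n \<times> 'n)" where
  "shift_h2 \<gamma> F \<Lambda> = (\<Sum>i\<in>UNIV. F (\<Lambda> + \<gamma> *s axis i 1) ** in_space_2 (diag_unit i))"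

text \<open>The arguments \<open>p1, p2, p12, p13, p23\<close> are the placements in tensor factors, with or without
  spectral parameters; \<open>\<iota>\<close> embeds scalar coefficients of two-space matrices into those with values
  in the algebra.\<close>

definition yang_baxter ::
    "('m2 \<Rightarrow> 'e::semiring_1^'k^'k) \<Rightarrow> ('m2 \<Rightarrow> 'e^'k^'k) \<Rightarrow> ('m2 \<Rightarrow> 'e^'k^'k)
      \<Rightarrow> (complex^'n \<Rightarrow> 'm2) \<Rightarrow> bool" where
  "yang_baxter p12 p13 p23 R \<longleftrightarrow>
     (\<forall>\<Lambda>. p12 (R \<Lambda>) ** p13 (R \<Lambda>) ** p23 (R \<Lambda>) = p23 (R \<Lambda>) ** p13 (R \<Lambda>) ** p12 (R \<Lambda>))"

definition A_mat ::
    "('m1 \<Rightarrow> 'c::semiring_1^('n \<times> 'n)^('n \<times> 'n)) \<Rightarrow> ('m1 \<Rightarrow> 'c^('n \<times> 'n)^('n \<times> 'n))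
      \<Rightarrow> (complex^'n \<Rightarrow> 'm1) \<Rightarrow> (complex^'n \<Rightarrow> 'c^('n \<times> 'n)^('n \<times> 'n))
      \<Rightarrow> complex^'n \<Rightarrow> 'c^('n \<times> 'n)^('n \<times> 'n)" where
  "A_mat p1 p2 b R \<Lambda> =
     matrix_inv (p1 (b \<Lambda>)) ** matrix_inv (p2 (b \<Lambda>)) ** R \<Lambda> ** p1 (b \<Lambda>) ** p2 (b \<Lambda>)"

definition B_mat ::
    "complex \<Rightarrow> ('m1 \<Rightarrow> 'c::semiring_1^('n \<times> 'n)^('n \<times> 'n))
      \<Rightarrow> (complex^'n \<Rightarrow> 'm1) \<Rightarrow> complex^'n \<Rightarrow> 'c^('n \<times> 'n)^('n \<times> 'n)" where
  "B_mat \<gamma> p2 b \<Lambda> = matrix_inv (p2 (b \<Lambda>)) ** shift_h1 \<gamma> (\<lambda>\<mu>. p2 (b \<mu>)) \<Lambda>"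

definition C_mat ::
    "complex \<Rightarrow> ('m1 \<Rightarrow> 'c::semiring_1^('n \<times> 'n)^('n \<times> 'n))
      \<Rightarrow> (complex^'n \<Rightarrow> 'm1) \<Rightarrow> complex^'n \<Rightarrow> 'c^('n \<times> 'n)^('n \<times> 'n)" where
  "C_mat \<gamma> p1 b \<Lambda> = matrix_inv (p1 (b \<Lambda>)) ** shift_h2 \<gamma> (\<lambda>\<mu>. p1 (b \<mu>)) \<Lambda>"

definition D_mat ::
    "complex \<Rightarrow> ('m1 \<Rightarrow> 'c::semiring_1^('n \<times> 'n)^('n \<times> 'n))
      \<Rightarrow> ('m1 \<Rightarrow> 'c^('n \<times> 'n)^('n \<times> 'n))
      \<Rightarrow> (complex^'n \<Rightarrow> 'm1) \<Rightarrow> (complex^'n \<Rightarrow> 'c^('n \<times> 'n)^('n \<times> 'n))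
      \<Rightarrow> complex^'n \<Rightarrow> 'c^('n \<times> 'n)^('n \<times> 'n)" where
  "D_mat \<gamma> p1 p2 q R' \<Lambda> =
     matrix_inv (shift_h2 \<gamma> (\<lambda>\<mu>. p1 (q \<mu>)) \<Lambda>) ** matrix_inv (p2 (q \<Lambda>)) ** R' \<Lambda>
       ** p1 (q \<Lambda>) ** shift_h1 \<gamma> (\<lambda>\<mu>. p2 (q \<mu>)) \<Lambda>"

definition exchange_relation ::
    "('m \<Rightarrow> 'd::semiring_1^('n \<times> 'n)^('n \<times> 'n)) \<Rightarrow> ('m \<Rightarrow> 'd^('n \<times> 'n)^('n \<times> 'n)) \<Rightarrow> ('c \<Rightarrow> 'd)
      \<Rightarrow> (complex^'n \<Rightarrow> 'c^('n \<times> 'n)^('n \<times> 'n)) \<Rightarrow> (complex^'n \<Rightarrow> 'c^('n \<times> 'n)^('n \<times> 'n))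
      \<Rightarrow> (complex^'n \<Rightarrow> 'm) \<Rightarrow> bool" where
  "exchange_relation p1 p2 \<iota> R R' Q \<longleftrightarrow>
     (\<forall>\<Lambda>. map_matrix \<iota> (R \<Lambda>) ** p1 (Q \<Lambda>) ** p2 (Q \<Lambda>)
        = p2 (Q \<Lambda>) ** p1 (Q \<Lambda>) ** map_matrix \<iota> (R' \<Lambda>))"

definition semi_dynamical_reflection ::
    "complex \<Rightarrow> ('m \<Rightarrow> 'd::semiring_1^('n \<times> 'n)^('n \<times> 'n)) \<Rightarrow> ('m \<Rightarrow> 'd^('n \<times> 'n)^('n \<times> 'n))
      \<Rightarrow> ('c \<Rightarrow> 'd)
      \<Rightarrow> (complex^'n \<Rightarrow> 'c^('n \<times> 'n)^('n \<times> 'n)) \<Rightarrow> (complex^'n \<Rightarrow> 'c^('n \<times> 'n)^('n \<times> 'n))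
      \<Rightarrow> (complex^'n \<Rightarrow> 'c^('n \<times> 'n)^('n \<times> 'n)) \<Rightarrow> (complex^'n \<Rightarrow> 'c^('n \<times> 'n)^('n \<times> 'n))
      \<Rightarrow> (complex^'n \<Rightarrow> 'm) \<Rightarrow> bool" where
  "semi_dynamical_reflection \<gamma> p1 p2 \<iota> A B C D K \<longleftrightarrow>
     (\<forall>\<Lambda>. map_matrix \<iota> (A \<Lambda>) ** p1 (K \<Lambda>) ** map_matrix \<iota> (B \<Lambda>) ** shift_h1 \<gamma> (\<lambda>\<mu>. p2 (K \<mu>)) \<Lambda>
        = p2 (K \<Lambda>) ** map_matrix \<iota> (C \<Lambda>) ** shift_h2 \<gamma> (\<lambda>\<mu>. p1 (K \<mu>)) \<Lambda> ** map_matrix \<iota> (D \<Lambda>))"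

definition K_mat ::
    "('c::semiring_1 \<Rightarrow> 'd::semiring_1) \<Rightarrow> (complex^'n \<Rightarrow> 'c^'n^'n) \<Rightarrow> (complex^'n \<Rightarrow> 'd^'n^'n)
      \<Rightarrow> (complex^'n \<Rightarrow> 'c^'n^'n) \<Rightarrow> complex^'n \<Rightarrow> 'd^'n^'n" where
  "K_mat \<iota> b Q q \<Lambda> = map_matrix \<iota> (matrix_inv (b \<Lambda>)) ** Q \<Lambda> ** map_matrix \<iota> (q \<Lambda>)"

end

(* Every factor depending on the dynamical variables through a shift by h_1 (resp. h_2) is block
   diagonal with respect to the first (resp. second) tensor index, and block-diagonal matrices multiply
   blockwise.  Hence K_2(h_1) = b_2(h_1)^{-1} Q_2 q_2(h_1) and K_1(h_2) = b_1(h_2)^{-1} Q_1 q_1(h_2).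
   Since scalar entries are central, scalar matrices acting in one space commute with all matrices acting
   in the other, and both sides of the reflection equation cancel down to
   b_1^{-1} b_2^{-1} X q_1 q_2(h_1), with X one of the two sides of the exchange relation. *)

theory Submission
  imports Defs
begin

section \<open>Block-diagonal matrices\<close>

text \<open>The sum over \<open>i\<close> of (e_ii)_1 (X_i)_2. This normal form covers both matrices
  acting in space 2 (constant family) and their shifts by h_1 (a family sampled at the shifted
  points).\<close>

definition block_diag_1 :: "('n \<Rightarrow> 'c::zero^'n^'n) \<Rightarrow> 'c^('n \<times> 'n)^('n \<times> 'n)" where
  "block_diag_1 X = (\<chi> r s. if fst r = fst s then X (fst r) $ snd r $ snd s else 0)"

definition block_diag_2 :: "('n \<Rightarrow> 'c::zero^'n^'n) \<Rightarrow> 'c^('n \<times> 'n)^('n \<times> 'n)" where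
  "block_diag_2 X = (\<chi> r s. if snd r = snd s then X (snd r) $ fst r $ fst s else 0)"

lemma in_space_2_eq_block_diag_1: "in_space_2 M = block_diag_1 (\<lambda>_. M)"
  by (simp add: in_space_2_def block_diag_1_def)

lemma in_space_1_eq_block_diag_2: "in_space_1 M = block_diag_2 (\<lambda>_. M)"
  by (simp add: in_space_1_def block_diag_2_def)

lemma sum_UNIV_prod:
  "(\<Sum>t\<in>UNIV. g t) = (\<Sum>i\<in>UNIV. \<Sum>j\<in>UNIV. g (i, j))"
  for g :: "'m::finite \<times> 'n::finite \<Rightarrow> 'c::comm_monoid_add"
  by (simp add: sum.cartesian_product flip: UNIV_Times_UNIV)

lemma sum_if_const:
  "(\<Sum>x\<in>A. if c then g x else 0) = (if c then \<Sum>x\<in>A. g x else (0::'c::comm_monoid_add))"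
  by simp

text \<open>Splits a sum over pairs of indices and moves the conditionals out of products and sums,
  so that Kronecker deltas collapse.\<close>

lemmas matrix_mult_delta = matrix_matrix_mult_def sum_UNIV_prod mult_delta_left mult_delta_right
  sum_if_const

lemma block_diag_1_mult:
  fixes X Y :: "'n::finite \<Rightarrow> 'c::semiring_1^'n^'n"
  shows "block_diag_1 X ** block_diag_1 Y = block_diag_1 (\<lambda>i. X i ** Y i)"
  by (simp add: vec_eq_iff block_diag_1_def matrix_mult_delta)

lemma block_diag_2_mult:
  fixes X Y :: "'n::finite \<Rightarrow> 'c::semiring_1^'n^'n"
  shows "block_diag_2 X ** block_diag_2 Y = block_diag_2 (\<lambda>i. X i ** Y i)"
  by (simp add: vec_eq_iff block_diag_2_def matrix_mult_delta)

lemma block_diag_1_one: "block_diag_1 (\<lambda>_. mat 1) = (mat 1 :: 'c::semiring_1^('n::finite \<times> 'n)^('n \<times> 'n))"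
  by (auto simp: block_diag_1_def mat_def vec_eq_iff prod_eq_iff)

lemma block_diag_2_one: "block_diag_2 (\<lambda>_. mat 1) = (mat 1 :: 'c::semiring_1^('n::finite \<times> 'n)^('n \<times> 'n))"
  by (auto simp: block_diag_2_def mat_def vec_eq_iff prod_eq_iff)

lemma map_matrix_block_diag_1:
  "f 0 = 0 \<Longrightarrow> map_matrix f (block_diag_1 X) = block_diag_1 (\<lambda>i. map_matrix f (X i))"
  by (simp add: block_diag_1_def map_matrix_def vec_eq_iff)

lemma map_matrix_block_diag_2:
  "f 0 = 0 \<Longrightarrow> map_matrix f (block_diag_2 X) = block_diag_2 (\<lambda>i. map_matrix f (X i))"
  by (simp add: block_diag_2_def map_matrix_def vec_eq_iff)

text \<open>The projector (e_mm)_1 keeps only the block with first index \<open>m\<close>, so the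
  summands fill distinct diagonal blocks.\<close>

lemma shift_h1_in_space_2:
  fixes X :: "complex^'n \<Rightarrow> 'c::semiring_1^'n^'n"
  shows "shift_h1 \<gamma> (\<lambda>\<mu>. in_space_2 (X \<mu>)) \<Lambda> = block_diag_1 (\<lambda>i. X (\<Lambda> + \<gamma> *s axis i 1))"
proof -
  have "(in_space_2 M ** in_space_1 (diag_unit m)) $ (i, k) $ (j, l)
      = (if i = m then if j = m then M $ k $ l else 0 else 0)" for M :: "'c^'n^'n" and m i j k l
    by (simp add: in_space_1_def in_space_2_def diag_unit_def matrix_mult_delta)
  then have "shift_h1 \<gamma> (\<lambda>\<mu>. in_space_2 (X \<mu>)) \<Lambda> $ (i, k) $ (j, l)
      = block_diag_1 (\<lambda>i. X (\<Lambda> + \<gamma> *s axis i 1)) $ (i, k) $ (j, l)" for i j k l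
    by (simp add: shift_h1_def block_diag_1_def)
  then show ?thesis
    by (simp add: vec_eq_iff)
qed

lemma shift_h2_in_space_1:
  fixes X :: "complex^'n \<Rightarrow> 'c::semiring_1^'n^'n"
  shows "shift_h2 \<gamma> (\<lambda>\<mu>. in_space_1 (X \<mu>)) \<Lambda> = block_diag_2 (\<lambda>i. X (\<Lambda> + \<gamma> *s axis i 1))"
proof -
  have "(in_space_1 M ** in_space_2 (diag_unit m)) $ (k, i) $ (l, j)
      = (if i = m then if j = m then M $ k $ l else 0 else 0)" for M :: "'c^'n^'n" and m i j k l
    by (simp add: in_space_1_def in_space_2_def diag_unit_def matrix_mult_delta)
  then have "shift_h2 \<gamma> (\<lambda>\<mu>. in_space_1 (X \<mu>)) \<Lambda> $ (k, i) $ (l, j)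
      = block_diag_2 (\<lambda>i. X (\<Lambda> + \<gamma> *s axis i 1)) $ (k, i) $ (l, j)" for i j k l
    by (simp add: shift_h2_def block_diag_2_def)
  then show ?thesis
    by (simp add: vec_eq_iff)
qed

text \<open>Each entry of either product is a single product of one entry of \<open>M\<close> and
  one of \<open>N\<close>; only the order of these two factors can differ.\<close>

lemma in_space_1_in_space_2_commute:
  fixes M N :: "'c::semiring_1^'n^'n"
  assumes "\<And>i j k l. M $ i $ j * N $ k $ l = N $ k $ l * M $ i $ j"
  shows "in_space_1 M ** in_space_2 N = in_space_2 N ** in_space_1 M"
  by (simp add: vec_eq_iff in_space_1_def in_space_2_def matrix_mult_delta assms)

section \<open>Inverses and unital homomorphisms\<close>

text \<open>\<open>matrix_inv\<close> chooses some two-sided inverse, and associativity leaves only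
  one candidate, even for noncommutative coefficients. Inverses of placed and shifted matrices can
  thus be found by exhibiting them.\<close>

lemma matrix_inv_unique:
  fixes A B :: "'c::semiring_1^'n^'n"
  assumes "A ** B = mat 1" "B ** A = mat 1"
  shows "matrix_inv A = B"
proof -
  have inv: "A ** matrix_inv A = mat 1 \<and> matrix_inv A ** A = mat 1"
    unfolding matrix_inv_def by (rule someI[of _ B]) (use assms in auto)
  then have "matrix_inv A = (B ** A) ** matrix_inv A"
    by (simp add: assms)
  also have "\<dots> = B"
    using inv by (simp flip: matrix_mul_assoc)
  finally show ?thesis .
qed

lemma matrix_inv_mult:
  fixes A :: "'c::semiring_1^'n^'n"
  assumes "invertible A"
  shows "A ** matrix_inv A = mat 1" "matrix_inv A ** A = mat 1"
  using assms unfolding invertible_def by (auto simp: matrix_inv_unique)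

locale unital_hom =
  fixes f :: "'x::ring_1 \<Rightarrow> 'y::ring_1"
  assumes hom_add: "f (x + y) = f x + f y"
    and hom_mult: "f (x * y) = f x * f y"
    and hom_one: "f 1 = 1"
begin

lemma hom_zero: "f 0 = 0"
  using hom_add[of 0 0] by simp

lemma hom_sum: "f (sum g A) = (\<Sum>x\<in>A. f (g x))"
  by (induction A rule: infinite_finite_induct) (simp_all add: hom_zero hom_add)

lemma map_matrix_mult: "map_matrix f (A ** B) = map_matrix f A ** map_matrix f B"
  by (simp add: vec_eq_iff map_matrix_def matrix_matrix_mult_def hom_sum hom_mult)

lemma map_matrix_one: "map_matrix f (mat 1) = mat 1"
  by (simp add: vec_eq_iff map_matrix_def mat_def hom_zero hom_one)

lemma unital_hom_map_fps: "unital_hom (map_fps f)"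
  by unfold_locales
    (auto simp: fps_eq_iff map_fps_def hom_add hom_zero hom_one fps_mult_nth hom_sum hom_mult)

lemma map_fps_fps_const: "map_fps f (fps_const x) = fps_const (f x)"
  by (auto simp: fps_eq_iff map_fps_def hom_zero)

end

lemma unital_hom_id: "unital_hom (\<lambda>x. x)"
  by unfold_locales auto

lemma unital_hom_fps_const: "unital_hom fps_const"
  by unfold_locales auto

locale central_hom = unital_hom f
  for f :: "'x::ring_1 \<Rightarrow> 'y::ring_1" +
  assumes central: "f x * y = y * f x"
begin

text \<open>Centrality of the coefficients swaps the factors in each term of the Cauchy product;
  reversing the summation index then gives the opposite product.\<close>

lemma central_hom_map_fps: "central_hom (map_fps f)"
proof -
  interpret F: unital_hom "map_fps f"
    by (rule unital_hom_map_fps)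
  have "fps_nth (map_fps f X * Y) n = fps_nth (Y * map_fps f X) n" for X :: "'x fps" and Y n
  proof -
    have "fps_nth (map_fps f X * Y) n = (\<Sum>i=0..n. fps_nth Y (n - i) * f (fps_nth X i))"
      by (simp add: fps_mult_nth map_fps_def central)
    also have "\<dots> = (\<Sum>i=0..n. fps_nth Y i * f (fps_nth X (n - i)))"
      by (subst sum.atLeastAtMost_rev) (auto intro!: sum.cong)
    finally show ?thesis
      by (simp add: fps_mult_nth map_fps_def)
  qed
  then show ?thesis
    by unfold_locales (simp add: fps_eq_iff)
qed

end

lemma (in complex_algebra) central_hom_of_scalar: "central_hom (of_scalar smul)"
  by unfold_locales
    (simp_all add: of_scalar_def scale_left_distrib smul_mult_left smul_mult_right)

section \<open>The reflection equation\<close>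

text \<open>The maps \<open>e\<^sub>1, e\<^sub>2\<close> and \<open>d\<^sub>1, d\<^sub>2\<close> substitute the spectral parameter of the respective space into
  scalar and algebra-valued coefficients; without spectral parameters they are identities.\<close>

locale spectral_placement =
  e1: unital_hom e1 + e2: unital_hom e2 + d1: unital_hom d1 + d2: unital_hom d2 +
  i0: unital_hom \<iota>\<^sub>0 + i: central_hom \<iota>
  for e1 e2 :: "'s::comm_ring_1 \<Rightarrow> 'c::comm_ring_1"
    and d1 d2 :: "'t::ring_1 \<Rightarrow> 'd::ring_1"
    and \<iota>\<^sub>0 :: "'s \<Rightarrow> 't" and \<iota> :: "'c \<Rightarrow> 'd" +
  assumes e1_compat: "d1 (\<iota>\<^sub>0 x) = \<iota> (e1 x)"
    and e2_compat: "d2 (\<iota>\<^sub>0 x) = \<iota> (e2 x)"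
begin

text \<open>In K the scalar factors are embedded by \<open>\<iota>\<^sub>0\<close> before the
  parameter is substituted; in A, B, C and D the substitution comes first and \<open>\<iota>\<close>
  second. This identifies the two orders.\<close>

lemma map_matrix_e1_compat:
  "map_matrix d1 (map_matrix \<iota>\<^sub>0 M) = map_matrix \<iota> (map_matrix e1 M)"
  by (simp add: map_matrix_def e1_compat)

lemma map_matrix_e2_compat:
  "map_matrix d2 (map_matrix \<iota>\<^sub>0 M) = map_matrix \<iota> (map_matrix e2 M)"
  by (simp add: map_matrix_def e2_compat)

text \<open>The entries of \<open>map_matrix \<iota> M\<close> are central. Two algebra-valued
  matrices in different spaces need not commute.\<close>

lemma commute_12:
  "in_space_1 (map_matrix \<iota> M) ** in_space_2 N = in_space_2 N ** in_space_1 (map_matrix \<iota> M)"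
  by (rule in_space_1_in_space_2_commute) (simp add: map_matrix_def i.central)

lemma commute_21:
  "in_space_2 (map_matrix \<iota> M) ** in_space_1 N = in_space_1 N ** in_space_2 (map_matrix \<iota> M)"
  by (rule in_space_1_in_space_2_commute[symmetric]) (simp add: map_matrix_def i.central)

text \<open>The placements are kept generic so that the cases with and without spectral parameters
  are both instances.\<close>

lemma reflection_from_exchange:
  fixes b q :: "complex^'n \<Rightarrow> 's^'n^'n"
    and R R' :: "complex^'n \<Rightarrow> 'c^('n \<times> 'n)^('n \<times> 'n)"
    and Q :: "complex^'n \<Rightarrow> 't^'n^'n"
  defines "p1 \<equiv> \<lambda>M. in_space_1 (map_matrix e1 M)" and "p2 \<equiv> \<lambda>M. in_space_2 (map_matrix e2 M)"
    and "P1 \<equiv> \<lambda>M. in_space_1 (map_matrix d1 M)" and "P2 \<equiv> \<lambda>M. in_space_2 (map_matrix d2 M)"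
  assumes b: "\<And>\<Lambda>. invertible (b \<Lambda>)" and q: "\<And>\<Lambda>. invertible (q \<Lambda>)"
    and Q: "non_dynamical \<gamma> Q"
    and exch: "exchange_relation P1 P2 \<iota> R R' Q"
  shows "semi_dynamical_reflection \<gamma> P1 P2 \<iota> (A_mat p1 p2 b R) (B_mat \<gamma> p2 b) (C_mat \<gamma> p1 b)
    (D_mat \<gamma> p1 p2 q R') (K_mat \<iota>\<^sub>0 b Q q)"
  unfolding semi_dynamical_reflection_def
proof
  fix \<Lambda> :: "complex^'n"
  let ?s = "\<lambda>F i. F (\<Lambda> + \<gamma> *s axis i 1)"
  define J1 where "J1 M = in_space_1 (map_matrix \<iota> (map_matrix e1 M))" for M :: "'s^'n^'n"
  define J2 where "J2 M = in_space_2 (map_matrix \<iota> (map_matrix e2 M))" for M :: "'s^'n^'n"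
  \<comment> \<open>The number names the space acted in: \<open>S1 M\<close> is M_1(h_2), with
    blocks indexed by space 2, and \<open>S2 M\<close> is M_2(h_1).\<close>
  define S1 where "S1 M = block_diag_2 (\<lambda>i. map_matrix \<iota> (map_matrix e1 (?s M i)))"
    for M :: "complex^'n \<Rightarrow> 's^'n^'n"
  define S2 where "S2 M = block_diag_1 (\<lambda>i. map_matrix \<iota> (map_matrix e2 (?s M i)))"
    for M :: "complex^'n \<Rightarrow> 's^'n^'n"
  define bi where "bi \<mu> = matrix_inv (b \<mu>)" for \<mu>
  define qi where "qi \<mu> = matrix_inv (q \<mu>)" for \<mu>
  define \<rho> where "\<rho> = map_matrix \<iota> (R \<Lambda>)"
  define \<rho>' where "\<rho>' = map_matrix \<iota> (R' \<Lambda>)"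
  note homs = e1.map_matrix_mult[symmetric] e2.map_matrix_mult[symmetric]
    e1.map_matrix_one e2.map_matrix_one i.map_matrix_mult[symmetric] i.map_matrix_one
  note blocks = in_space_1_eq_block_diag_2 in_space_2_eq_block_diag_1 block_diag_1_mult
    block_diag_2_mult block_diag_1_one block_diag_2_one
  have inv: "b \<mu> ** bi \<mu> = mat 1" "bi \<mu> ** b \<mu> = mat 1" "q \<mu> ** qi \<mu> = mat 1"
    "qi \<mu> ** q \<mu> = mat 1" for \<mu>
    using b q by (simp_all add: bi_def qi_def matrix_inv_mult)
  have p_inv: "matrix_inv (p1 (b \<Lambda>)) = p1 (bi \<Lambda>)" "matrix_inv (p2 (b \<Lambda>)) = p2 (bi \<Lambda>)"
    "matrix_inv (p2 (q \<Lambda>)) = p2 (qi \<Lambda>)"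
    by (rule matrix_inv_unique; simp add: p1_def p2_def homs blocks inv)+
  \<comment> \<open>Block-diagonal matrices are inverted blockwise; this uses invertibility of
    \<open>q\<close> at the shifted points.\<close>
  have sh_inv: "matrix_inv (shift_h2 \<gamma> (\<lambda>\<mu>. p1 (q \<mu>)) \<Lambda>) = shift_h2 \<gamma> (\<lambda>\<mu>. p1 (qi \<mu>)) \<Lambda>"
    unfolding p1_def shift_h2_in_space_1
    by (rule matrix_inv_unique) (simp_all add: homs blocks inv)
  have map_p1: "map_matrix \<iota> (p1 M) = J1 M" and map_p2: "map_matrix \<iota> (p2 M) = J2 M" for M :: "'s^'n^'n"
    by (simp_all add: p1_def p2_def J1_def J2_def in_space_1_eq_block_diag_2
        in_space_2_eq_block_diag_1 map_matrix_block_diag_1 map_matrix_block_diag_2 i.hom_zero)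
  have map_sh1: "map_matrix \<iota> (shift_h1 \<gamma> (\<lambda>\<mu>. p2 (M \<mu>)) \<Lambda>) = S2 M"
    and map_sh2: "map_matrix \<iota> (shift_h2 \<gamma> (\<lambda>\<mu>. p1 (M \<mu>)) \<Lambda>) = S1 M"
    for M :: "complex^'n \<Rightarrow> 's^'n^'n"
    by (simp_all add: p1_def p2_def S1_def S2_def shift_h1_in_space_2 shift_h2_in_space_1
        map_matrix_block_diag_1 map_matrix_block_diag_2 i.hom_zero)
  have A: "map_matrix \<iota> (A_mat p1 p2 b R \<Lambda>)
      = J1 (bi \<Lambda>) ** J2 (bi \<Lambda>) ** \<rho> ** J1 (b \<Lambda>) ** J2 (b \<Lambda>)"
    by (simp add: A_mat_def i.map_matrix_mult p_inv map_p1 map_p2 \<rho>_def)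
  have B: "map_matrix \<iota> (B_mat \<gamma> p2 b \<Lambda>) = J2 (bi \<Lambda>) ** S2 b"
    by (simp add: B_mat_def i.map_matrix_mult p_inv map_p2 map_sh1)
  have C: "map_matrix \<iota> (C_mat \<gamma> p1 b \<Lambda>) = J1 (bi \<Lambda>) ** S1 b"
    by (simp add: C_mat_def i.map_matrix_mult p_inv map_p1 map_sh2)
  have D: "map_matrix \<iota> (D_mat \<gamma> p1 p2 q R' \<Lambda>)
      = S1 qi ** J2 (qi \<Lambda>) ** \<rho>' ** J1 (q \<Lambda>) ** S2 q"
    by (simp add: D_mat_def i.map_matrix_mult p_inv sh_inv map_p1 map_p2 map_sh1 map_sh2 \<rho>'_def)
  \<comment> \<open>All blocks of the shifted Q coincide, so Q_1(h_2) and Q_2(h_1) are just Q_1 and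
    Q_2.\<close>
  have Q_shift: "?s Q i = Q \<Lambda>" for i
    using Q by (simp add: non_dynamical_def)
  note expand = K_mat_def P1_def P2_def J1_def J2_def S1_def S2_def bi_def Q_shift
    d1.map_matrix_mult d2.map_matrix_mult map_matrix_e1_compat map_matrix_e2_compat blocks
  have K1: "P1 (K_mat \<iota>\<^sub>0 b Q q \<Lambda>) = J1 (bi \<Lambda>) ** P1 (Q \<Lambda>) ** J1 (q \<Lambda>)"
    and K2: "P2 (K_mat \<iota>\<^sub>0 b Q q \<Lambda>) = J2 (bi \<Lambda>) ** P2 (Q \<Lambda>) ** J2 (q \<Lambda>)"
    by (simp_all add: expand)
  have K1_h2: "shift_h2 \<gamma> (\<lambda>\<mu>. P1 (K_mat \<iota>\<^sub>0 b Q q \<mu>)) \<Lambda> = S1 bi ** P1 (Q \<Lambda>) ** S1 q"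
    and K2_h1: "shift_h1 \<gamma> (\<lambda>\<mu>. P2 (K_mat \<iota>\<^sub>0 b Q q \<mu>)) \<Lambda> = S2 bi ** P2 (Q \<Lambda>) ** S2 q"
    unfolding P1_def P2_def shift_h1_in_space_2 shift_h2_in_space_1 by (simp_all add: expand)
  \<comment> \<open>The free left factor \<open>X\<close> lets the rules fire inside products nested
    to the left, the form produced by \<open>matrix_mul_assoc\<close>.\<close>
  have cancel: "X ** J2 (b \<Lambda>) ** J2 (bi \<Lambda>) = X" "X ** J1 (b \<Lambda>) ** J1 (bi \<Lambda>) = X"
    "X ** J2 (q \<Lambda>) ** J2 (qi \<Lambda>) = X" "X ** S1 b ** S1 bi = X" "X ** S2 b ** S2 bi = X"
    "X ** S1 q ** S1 qi = X" for X
  proof -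
    have one: "J2 (b \<Lambda>) ** J2 (bi \<Lambda>) = mat 1" "J1 (b \<Lambda>) ** J1 (bi \<Lambda>) = mat 1"
      "J2 (q \<Lambda>) ** J2 (qi \<Lambda>) = mat 1" "S1 b ** S1 bi = mat 1" "S2 b ** S2 bi = mat 1"
      "S1 q ** S1 qi = mat 1"
      by (simp_all add: J1_def J2_def S1_def S2_def blocks homs inv)
    show "X ** J2 (b \<Lambda>) ** J2 (bi \<Lambda>) = X" "X ** J1 (b \<Lambda>) ** J1 (bi \<Lambda>) = X"
      "X ** J2 (q \<Lambda>) ** J2 (qi \<Lambda>) = X" "X ** S1 b ** S1 bi = X" "X ** S2 b ** S2 bi = X"
      "X ** S1 q ** S1 qi = X"
      by (simp_all add: one flip: matrix_mul_assoc)
  qed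
  \<comment> \<open>Every rule moves a space-1 factor to the left of a space-2 factor. The pair
    \<open>P2 Y\<close>, \<open>P1 Y\<close> is left alone: its reordering is the content of the
    exchange relation.\<close>
  have comm: "X ** J2 M ** J1 N = X ** J1 N ** J2 M"
    "X ** J2 M ** P1 Y = X ** P1 Y ** J2 M" "X ** P2 Y ** J1 M = X ** J1 M ** P2 Y" for X M N Y
  proof -
    have "J2 M ** J1 N = J1 N ** J2 M" "J2 M ** P1 Y = P1 Y ** J2 M" "P2 Y ** J1 M = J1 M ** P2 Y"
      unfolding J1_def J2_def P1_def P2_def by (rule commute_21 commute_12[symmetric])+
    then show "X ** J2 M ** J1 N = X ** J1 N ** J2 M"
      "X ** J2 M ** P1 Y = X ** P1 Y ** J2 M" "X ** P2 Y ** J1 M = X ** J1 M ** P2 Y"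
      by (simp_all flip: matrix_mul_assoc)
  qed
  \<comment> \<open>Covers a product that starts with \<open>J2 M\<close>, where no left factor is
    present.\<close>
  have comm': "J2 M ** J1 N = J1 N ** J2 M" for M N
    using comm(1)[of "mat 1" M N] by simp
  \<comment> \<open>b_2 at the end of A passes K_1 and cancels against b_2^{-1} in B; then b_2(h_1)
    cancels between B and K_2(h_1).\<close>
  have "map_matrix \<iota> (A_mat p1 p2 b R \<Lambda>) ** P1 (K_mat \<iota>\<^sub>0 b Q q \<Lambda>) ** map_matrix \<iota> (B_mat \<gamma> p2 b \<Lambda>)
        ** shift_h1 \<gamma> (\<lambda>\<mu>. P2 (K_mat \<iota>\<^sub>0 b Q q \<mu>)) \<Lambda>
      = J1 (bi \<Lambda>) ** J2 (bi \<Lambda>) ** (\<rho> ** P1 (Q \<Lambda>) ** P2 (Q \<Lambda>)) ** J1 (q \<Lambda>) ** S2 q"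
    by (simp add: A B K1 K2_h1 matrix_mul_assoc comm comm' cancel)
  also have "\<rho> ** P1 (Q \<Lambda>) ** P2 (Q \<Lambda>) = P2 (Q \<Lambda>) ** P1 (Q \<Lambda>) ** \<rho>'"
    using exch by (simp add: exchange_relation_def \<rho>_def \<rho>'_def)
  \<comment> \<open>Here b_1(h_2) cancels between C and K_1(h_2), and q_1(h_2) between K_1(h_2) and
    D; q_2 from K_2 then meets q_2^{-1} in D.\<close>
  also have "J1 (bi \<Lambda>) ** J2 (bi \<Lambda>) ** (P2 (Q \<Lambda>) ** P1 (Q \<Lambda>) ** \<rho>') ** J1 (q \<Lambda>) ** S2 q
      = P2 (K_mat \<iota>\<^sub>0 b Q q \<Lambda>) ** map_matrix \<iota> (C_mat \<gamma> p1 b \<Lambda>)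
        ** shift_h2 \<gamma> (\<lambda>\<mu>. P1 (K_mat \<iota>\<^sub>0 b Q q \<mu>)) \<Lambda> ** map_matrix \<iota> (D_mat \<gamma> p1 p2 q R' \<Lambda>)"
    by (simp add: C D K2 K1_h2 matrix_mul_assoc comm comm' cancel)
  finally show "map_matrix \<iota> (A_mat p1 p2 b R \<Lambda>) ** P1 (K_mat \<iota>\<^sub>0 b Q q \<Lambda>)
        ** map_matrix \<iota> (B_mat \<gamma> p2 b \<Lambda>) ** shift_h1 \<gamma> (\<lambda>\<mu>. P2 (K_mat \<iota>\<^sub>0 b Q q \<mu>)) \<Lambda>
      = P2 (K_mat \<iota>\<^sub>0 b Q q \<Lambda>) ** map_matrix \<iota> (C_mat \<gamma> p1 b \<Lambda>)
        ** shift_h2 \<gamma> (\<lambda>\<mu>. P1 (K_mat \<iota>\<^sub>0 b Q q \<mu>)) \<Lambda> ** map_matrix \<iota> (D_mat \<gamma> p1 p2 q R' \<Lambda>)" .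
qed

end

section \<open>Specialisation to constant and to power series coefficients\<close>

theorem mainTheorem3:
  fixes \<gamma> :: complex
    and smul :: "complex \<Rightarrow> 'a::ring_1 \<Rightarrow> 'a"
    and b q :: "complex^'n \<Rightarrow> complex^'n^'n"
    and R R' :: "complex^'n \<Rightarrow> complex^('n \<times> 'n)^('n \<times> 'n)"
    and Q :: "complex^'n \<Rightarrow> 'a^'n^'n"
    and b_u q_u :: "complex^'n \<Rightarrow> complex fps^'n^'n"
    and R_u R'_u :: "complex^'n \<Rightarrow> complex fps fps^('n \<times> 'n)^('n \<times> 'n)"
    and Q_u :: "complex^'n \<Rightarrow> 'a fps^'n^'n"
  assumes "\<gamma> \<noteq> 0"
    and "complex_algebra smul"
  shows
    "((\<forall>\<Lambda>. invertible (b \<Lambda>)) \<and> (\<forall>\<Lambda>. invertible (q \<Lambda>))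
        \<and> non_dynamical \<gamma> R \<and> yang_baxter in_space_12 in_space_13 in_space_23 R
        \<and> non_dynamical \<gamma> R' \<and> yang_baxter in_space_12 in_space_13 in_space_23 R'
        \<and> non_dynamical \<gamma> Q
        \<and> exchange_relation in_space_1 in_space_2 (of_scalar smul) R R' Q
      \<longrightarrow> semi_dynamical_reflection \<gamma> in_space_1 in_space_2 (of_scalar smul)
            (A_mat in_space_1 in_space_2 b R) (B_mat \<gamma> in_space_2 b)
            (C_mat \<gamma> in_space_1 b) (D_mat \<gamma> in_space_1 in_space_2 q R')
            (K_mat (of_scalar smul) b Q q))
   \<and> ((\<forall>\<Lambda>. invertible (b_u \<Lambda>)) \<and> (\<forall>\<Lambda>. invertible (q_u \<Lambda>))
        \<and> non_dynamical \<gamma> R_u \<and> yang_baxter in_space_12_u in_space_13_u in_space_23_u R_u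
        \<and> non_dynamical \<gamma> R'_u \<and> yang_baxter in_space_12_u in_space_13_u in_space_23_u R'_u
        \<and> non_dynamical \<gamma> Q_u
        \<and> exchange_relation in_space_1_u in_space_2_u (map_fps (map_fps (of_scalar smul))) R_u R'_u Q_u
      \<longrightarrow> semi_dynamical_reflection \<gamma> in_space_1_u in_space_2_u (map_fps (map_fps (of_scalar smul)))
            (A_mat in_space_1_u in_space_2_u b_u R_u) (B_mat \<gamma> in_space_2_u b_u)
            (C_mat \<gamma> in_space_1_u b_u) (D_mat \<gamma> in_space_1_u in_space_2_u q_u R'_u)
            (K_mat (map_fps (of_scalar smul)) b_u Q_u q_u))"
proof -
  interpret complex_algebra smul
    by fact
  interpret s: central_hom "of_scalar smul"
    by (rule central_hom_of_scalar)
  interpret sf: central_hom "map_fps (of_scalar smul)"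
    by (rule s.central_hom_map_fps)
  interpret sff: central_hom "map_fps (map_fps (of_scalar smul))"
    by (rule sf.central_hom_map_fps)
  interpret c: unital_hom "fps_const :: complex \<Rightarrow> complex fps"
    by (rule unital_hom_fps_const)
  interpret c': unital_hom "fps_const :: 'a \<Rightarrow> 'a fps"
    by (rule unital_hom_fps_const)
  interpret plain: spectral_placement "\<lambda>x. x" "\<lambda>x. x" "\<lambda>x. x" "\<lambda>x. x" "of_scalar smul" "of_scalar smul"
    by (intro spectral_placement.intro unital_hom_id s.unital_hom_axioms s.central_hom_axioms
        spectral_placement_axioms.intro refl)
  \<comment> \<open>The inner variable is u_1: \<open>fps_const\<close> makes a series in u_1
    constant in u_2, while \<open>map_fps fps_const\<close> makes each coefficient constant in u_1,
    leaving a series in u_2.\<close>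
  interpret param: spectral_placement fps_const "map_fps fps_const" fps_const "map_fps fps_const"
    "map_fps (of_scalar smul)" "map_fps (map_fps (of_scalar smul))"
  proof (intro spectral_placement.intro unital_hom_fps_const c.unital_hom_map_fps
      c'.unital_hom_map_fps sf.unital_hom_axioms sff.central_hom_axioms
      spectral_placement_axioms.intro)
    show "fps_const (map_fps (of_scalar smul) x) = map_fps (map_fps (of_scalar smul)) (fps_const x)" for x
      by (simp add: sf.map_fps_fps_const)
    show "map_fps fps_const (map_fps (of_scalar smul) x)
        = map_fps (map_fps (of_scalar smul)) (map_fps fps_const x)" for x
      by (simp add: fps_eq_iff map_fps_def s.hom_zero)
  qed
  have id: "map_matrix (\<lambda>x. x) M = M" for M :: "'z^'i^'j"
    by (simp add: map_matrix_def)
  have fold_u: "(\<lambda>M. in_space_1 (map_matrix fps_const M)) = in_space_1_u"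
    "(\<lambda>M. in_space_2 (map_matrix (map_fps fps_const) M)) = in_space_2_u"
    by (simp_all add: fun_eq_iff in_space_1_u_def in_space_2_u_def)
  show ?thesis
    using plain.reflection_from_exchange[of b q \<gamma> Q R R', unfolded id]
      param.reflection_from_exchange[of b_u q_u \<gamma> Q_u R_u R'_u, unfolded fold_u]
    by blast
qed

end
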